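(* For all sufficiently large integers $n$, every $2$-coloring of the edges of the complete graph on the vertex set $\{2,\ldots,n\}$ contains a monochromatic clique with vertex set $S$ such that $$\sum_{s \in S} \frac{1}{\log s} \geq 2^{-8} \log \log \log n.$$ Hence $f(n)=\Theta(\log \log \log n)$.
   Context: All logarithms are base $2$. For a finite set $S$ of integers greater than one, its weight is $w(S)=\sum_{s\in S} \frac{1}{\log s}$. For a red-blue coloring $c$ of the edges of the complete graph on $\{2,\ldots,n\}$, let $f(c)$ be the maximum of $w(S)$ over all sets $S\subset\{2,\ldots,n\}$ which form a monochromatic clique in $c$. For each integer $n\ge 2$, $f(n)$ is the minimum of $f(c)$ over all red-blue edge-colorings $c$ of the complete graph on $\{2,\ldots,n\}$. *)

theory Defs
  imports Complex_Main "HOL-Library.FuncSet" "HOL-Library.Ramsey" "HOL-Library.Landau_Symbols"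
begin

datatype color = Red | Blue

text \<open>The edges of the complete graph on \<open>V\<close> are the 2-element subsets \<open>[V]\<^bsup>2\<^esup>\<close>.
  Colorings are extensional functions, so each coloring of the edges occurs exactly once and
  there are only finitely many of them.\<close>

definition edge_colorings :: "nat \<Rightarrow> (nat set \<Rightarrow> color) set" where
  "edge_colorings n = [{2..n}]\<^bsup>2\<^esup> \<rightarrow>\<^sub>E UNIV"

definition weight :: "nat set \<Rightarrow> real" where
  "weight S = (\<Sum>s\<in>S. 1 / log 2 (real s))"

text \<open>Sets with at most one element span no edges and count as monochromatic cliques.\<close>

definition mono_clique :: "nat \<Rightarrow> (nat set \<Rightarrow> color) \<Rightarrow> nat set \<Rightarrow> bool" where
  "mono_clique n c S \<longleftrightarrow> S \<subseteq> {2..n} \<and> (\<exists>col. \<forall>e\<in>[S]\<^bsup>2\<^esup>. c e = col)"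

definition f_col :: "nat \<Rightarrow> (nat set \<Rightarrow> color) \<Rightarrow> real" where
  "f_col n c = Max (weight ` {S. mono_clique n c S})"

definition f :: "nat \<Rightarrow> real" where
  "f n = Min (f_col n ` edge_colorings n)"

text \<open>The maximum and the minimum range over finite nonempty sets.\<close>

lemma finite_mono_cliques: "finite {S. mono_clique n c S}"
  by (rule finite_subset[of _ "Pow {2..n}"]) (auto simp: mono_clique_def)

lemma mono_cliques_nonempty: "{S. mono_clique n c S} \<noteq> {}"
proof -
  have "mono_clique n c {}" by (simp add: mono_clique_def nsets_def)
  then show ?thesis by blast
qed

lemma finite_edge_colorings: "finite (edge_colorings n)"
proof -
  have "(UNIV :: color set) = {Red, Blue}" using color.exhaust by auto
  then have "finite (UNIV :: color set)" by (metis finite.emptyI finite_insert)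
  then show ?thesis
    unfolding edge_colorings_def by (intro finite_PiE finite_imp_finite_nsets) auto
qed

lemma edge_colorings_nonempty: "edge_colorings n \<noteq> {}"
  by (simp add: edge_colorings_def PiE_eq_empty_iff)

end

theory Submission
  imports Defs "HOL-Real_Asymp.Real_Asymp"
begin

text \<open>
  Lower bound. Let \<open>M\<close> be about \<open>\<surd>(log log n)\<close> and take \<open>M\<close> dyadic blocks \<open>B\<^sub>1, \<dots>, B\<^sub>M\<close> of
  integers with logarithm about \<open>L\<^sub>j = (64 M\<^sup>4)\<^sup>j\<close>. Dependent random choice shrinks \<open>B\<^sub>1\<close> to a set
  \<open>A\<close> with \<open>log \<bar>A\<bar> \<ge> L\<^sub>1 / 2\<close> such that, for every later block \<open>B\<^sub>j\<close> and a color depending only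
  on \<open>j\<close>, all sets of \<open>O(M L\<^sub>1)\<close> vertices of \<open>A\<close> have a large common neighborhood of that color in
  \<open>B\<^sub>j\<close>. Largest red and blue cliques of \<open>A\<close> contribute weights at least \<open>r\<close> and \<open>b\<close> with
  \<open>exp (- 8 r) + exp (- 8 b) \<le> 1\<close>, by an off-diagonal Erdos--Szekeres bound. Passing to the common
  neighborhoods of these cliques and recursing separately on the later blocks joined in red and
  on those joined in blue is a weighted Erdos--Szekeres argument: it gives \<open>M < exp (8 (X + Y))\<close>
  when red cliques have weight at most \<open>X\<close> and blue ones at most \<open>Y\<close>.

  Upper bound. Color the pairs inside each block \<open>2\<^sup>i \<le> log s < 2\<^sup>i\<^sup>+\<^sup>1\<close>, and the pairs of
  distinct blocks, by colorings with logarithmic clique number. A monochromatic clique then meets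
  \<open>O(log log log n)\<close> blocks, with bounded weight in each.
\<close>

section \<open>Monochromatic sets and off-diagonal Erdos--Szekeres bounds\<close>

definition monochromatic :: "('a set \<Rightarrow> color) \<Rightarrow> color \<Rightarrow> 'a set \<Rightarrow> bool" where
  "monochromatic c col S \<longleftrightarrow> (\<forall>x\<in>S. \<forall>y\<in>S. x \<noteq> y \<longrightarrow> c {x, y} = col)"

lemma monochromatic_empty [simp]: "monochromatic c col {}"
  by (simp add: monochromatic_def)

lemma monochromatic_singleton [simp]: "monochromatic c col {x}"
  by (simp add: monochromatic_def)

lemma monochromatic_subset:
  "monochromatic c col S \<Longrightarrow> T \<subseteq> S \<Longrightarrow> monochromatic c col T"
  by (auto simp: monochromatic_def)

lemma monochromatic_Un:
  assumes "monochromatic c col S" "monochromatic c col T"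
    and "\<And>x y. x \<in> S \<Longrightarrow> y \<in> T \<Longrightarrow> c {x, y} = col"
  shows "monochromatic c col (S \<union> T)"
  using assms unfolding monochromatic_def by (metis Un_iff insert_commute)

lemma monochromatic_insert:
  assumes "monochromatic c col S" "\<And>x. x \<in> S \<Longrightarrow> c {v, x} = col"
  shows "monochromatic c col (insert v S)"
  using monochromatic_Un[of c col "{v}" S] assms by simp

lemma color_neq_iff: "col \<noteq> Red \<longleftrightarrow> col = Blue"
  by (cases col) auto

lemma monochromatic_iff_nsets: "monochromatic c col S \<longleftrightarrow> (\<forall>e\<in>[S]\<^bsup>2\<^esup>. c e = col)"
proof
  assume "\<forall>e\<in>[S]\<^bsup>2\<^esup>. c e = col"
  moreover have "{x, y} \<in> [S]\<^bsup>2\<^esup>" if "x \<in> S" "y \<in> S" "x \<noteq> y" for x y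
    using that by (simp add: nsets_def)
  ultimately show "monochromatic c col S" by (simp add: monochromatic_def)
qed (auto simp: monochromatic_def nsets_def card_2_iff)

text \<open>Split \<open>V - {v}\<close> into the red and the blue neighborhood of a vertex
  \<open>v\<close>. Every red clique of the first extends by \<open>v\<close>, which lowers the red
  budget \<open>X\<close> by \<open>r\<close>; likewise \<open>Y\<close> drops by \<open>b\<close>
  on the blue side. The summand 1 is there so that the two bounds add up with \<open>v\<close>
  counted, and \<open>rb\<close> recombines the exponentials.\<close>

lemma weighted_Erdos_Szekeres:
  fixes r b X Y :: real
  assumes "finite V" and rb: "exp (- r) + exp (- b) \<le> 1"
    and "\<And>S. S \<subseteq> V \<Longrightarrow> monochromatic c Red S \<Longrightarrow> r * card S \<le> X"
    and "\<And>S. S \<subseteq> V \<Longrightarrow> monochromatic c Blue S \<Longrightarrow> b * card S \<le> Y"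
  shows "card V + 1 \<le> exp (X + Y)"
  using assms(1,3,4)
proof (induction V arbitrary: X Y rule: finite_psubset_induct)
  case (psubset V)
  show ?case
  proof (cases "V = {}")
    case True
    have "0 \<le> X" "0 \<le> Y" using psubset.prems[of "{}"] by simp_all
    then show ?thesis using True by simp
  next
    case False
    then obtain v where v: "v \<in> V" by blast
    define VR where "VR = {x \<in> V - {v}. c {v, x} = Red}"
    define VB where "VB = {x \<in> V - {v}. c {v, x} = Blue}"
    have part: "V = insert v (VR \<union> VB)" "VR \<inter> VB = {}" "v \<notin> VR" "v \<notin> VB"
      using v color_neq_iff by (auto simp: VR_def VB_def)
    have fin: "finite VR" "finite VB"
      using psubset.hyps by (auto simp: VR_def VB_def)
    have sub: "VR \<subset> V" "VB \<subset> V" using part by blast+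
    have card: "card V = 1 + card VR + card VB"
      using part fin by (simp add: card_Un_disjoint)
    have R: "card VR + 1 \<le> exp ((X - r) + Y)"
    proof (rule psubset.IH[OF sub(1)])
      fix S assume S: "S \<subseteq> VR" "monochromatic c Red S"
      have "monochromatic c Red (insert v S)"
        using S by (intro monochromatic_insert) (auto simp: VR_def)
      moreover have "card (insert v S) = card S + 1"
        using S(1) part(3) finite_subset[OF S(1) fin(1)] by (subst card_insert_disjoint) auto
      ultimately show "r * card S \<le> X - r"
        using psubset.prems(1)[of "insert v S"] S v sub by (auto simp: algebra_simps)
    qed (use psubset.prems sub in auto)
    have B: "card VB + 1 \<le> exp (X + (Y - b))"
    proof (rule psubset.IH[OF sub(2)])
      fix S assume S: "S \<subseteq> VB" "monochromatic c Blue S"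
      have "monochromatic c Blue (insert v S)"
        using S by (intro monochromatic_insert) (auto simp: VB_def)
      moreover have "card (insert v S) = card S + 1"
        using S(1) part(4) finite_subset[OF S(1) fin(2)] by (subst card_insert_disjoint) auto
      ultimately show "b * card S \<le> Y - b"
        using psubset.prems(2)[of "insert v S"] S v sub by (auto simp: algebra_simps)
    qed (use psubset.prems sub in auto)
    have "card V + 1 \<le> exp ((X - r) + Y) + exp (X + (Y - b))"
      using R B card by simp
    also have "\<dots> = exp (X + Y) * (exp (- r) + exp (- b))"
      by (simp add: algebra_simps flip: exp_add)
    also have "\<dots> \<le> exp (X + Y)" using mult_left_mono[OF rb, of "exp (X + Y)"] by simp
    finally show ?thesis .
  qed
qed

text \<open>Apply ln x <= x - 1 at 1 / p and at 1 / (1 - p): the resulting bounds on the two factors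
  are reciprocal to each other.\<close>

lemma ln_mult_ln_le_1:
  fixes p :: real
  assumes "0 < p" "p < 1"
  shows "ln p * ln (1 - p) \<le> 1"
proof -
  have "- ln p \<le> (1 - p) / p"
    using ln_le_minus_one[of "1 / p"] assms by (simp add: ln_div diff_divide_distrib)
  moreover have "- ln (1 - p) \<le> p / (1 - p)"
    using ln_le_minus_one[of "1 / (1 - p)"] assms by (simp add: ln_div field_simps)
  ultimately have "(- ln p) * (- ln (1 - p)) \<le> ((1 - p) / p) * (p / (1 - p))"
    using assms by (intro mult_mono) auto
  then show ?thesis using assms by simp
qed

lemma max_monochromatic:
  assumes "finite V"
  obtains K where "K \<subseteq> V" "monochromatic c col K"
    "\<And>S. S \<subseteq> V \<Longrightarrow> monochromatic c col S \<Longrightarrow> card S \<le> card K"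
proof -
  let ?P = "\<lambda>S. S \<subseteq> V \<and> monochromatic c col S"
  have "\<exists>K. ?P K \<and> (\<forall>S. ?P S \<longrightarrow> card S \<le> card K)"
    by (rule ex_has_greatest_nat[of ?P "{}" card "Suc (card V)"])
      (use assms in \<open>auto simp: less_Suc_eq_le card_mono\<close>)
  then show ?thesis using that by blast
qed

text \<open>The off-diagonal trade-off: were the inequality false, Erdos--Szekeres with rates read off
  from \<open>p = exp (- 8 R / L)\<close> in the swapped roles (blue gets \<open>p\<close>, red gets \<open>1 - p\<close>) would
  bound \<open>ln (card A)\<close> by \<open>(L / 4) ln p ln (1 - p)\<close>.\<close>

lemma clique_sizes_tradeoff:
  fixes L :: real
  assumes "finite A" and L: "0 < L" and big: "2 powr (L / 2) \<le> card A"
    and R: "\<And>S. S \<subseteq> A \<Longrightarrow> monochromatic c Red S \<Longrightarrow> card S \<le> R"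
    and B: "\<And>S. S \<subseteq> A \<Longrightarrow> monochromatic c Blue S \<Longrightarrow> card S \<le> B"
  shows "exp (- (8 * (R / L))) + exp (- (8 * (B / L))) \<le> 1"
proof (rule ccontr)
  assume neg: "\<not> ?thesis"
  define p where "p = exp (- (8 * (R / L)))"
  have "0 < 2 powr (L / 2)" by simp
  with big have "0 < card A" by linarith
  then obtain v where "v \<in> A" by fastforce
  then have R1: "1 \<le> R" using R[of "{v}"] by simp
  have p: "0 < p" "p < 1" using R1 L by (auto simp: p_def)
  have lnp: "- ln p * (L / 8) = R" using L by (simp add: p_def)
  have "1 - p < exp (- (8 * (B / L)))" using neg by (simp add: p_def)
  then have "ln (1 - p) < - (8 * (B / L))"
    using p ln_less_cancel_iff[of "1 - p" "exp (- (8 * (B / L)))"] by simp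
  then have lnq: "B \<le> - ln (1 - p) * (L / 8)" using L by (simp add: field_simps)
  have "card A + 1 \<le> exp (R * - ln (1 - p) + B * - ln p)"
  proof (rule weighted_Erdos_Szekeres[where c = c and r = "- ln (1 - p)" and b = "- ln p"])
    show "exp (- (- ln (1 - p))) + exp (- (- ln p)) \<le> 1" using p by simp
  next
    fix S assume "S \<subseteq> A" "monochromatic c Red S"
    then show "- ln (1 - p) * card S \<le> R * - ln (1 - p)"
      using R p by (simp add: mult.commute mult_right_mono)
  next
    fix S assume "S \<subseteq> A" "monochromatic c Blue S"
    then show "- ln p * card S \<le> B * - ln p"
      using B p by (simp add: mult.commute mult_right_mono)
  qed fact
  \<comment> \<open>The red term equals (L / 8) ln p ln (1 - p) by the choice of \<open>p\<close>,
    and the blue term is at most that by \<open>lnq\<close>.\<close>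
  moreover have "R * - ln (1 - p) + B * - ln p \<le> L / 4"
  proof -
    have "B * - ln p \<le> (- ln (1 - p) * (L / 8)) * - ln p"
      using lnq p by (intro mult_right_mono) auto
    then have "R * - ln (1 - p) + B * - ln p \<le> (L / 4) * (ln p * ln (1 - p))"
      unfolding lnp[symmetric] by (simp add: algebra_simps)
    also have "\<dots> \<le> L / 4" using mult_left_mono[OF ln_mult_ln_le_1[OF p], of "L / 4"] L by simp
    finally show ?thesis .
  qed
  ultimately have "card A + 1 \<le> exp (L / 4)" by (meson exp_le_cancel_iff order_trans)
  \<comment> \<open>This amounts to ln 2 >= 1/2, which is ln x <= x - 1 at x = 1/2.\<close>
  moreover have "exp (L / 4) \<le> 2 powr (L / 2)"
    using ln_le_minus_one[of "1 / 2"] L by (simp add: powr_def ln_div)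
  ultimately show False using big by linarith
qed

section \<open>Dependent random choice\<close>

text \<open>A set of size k + 1 arises by inserting an element of \<open>A\<close> into a set of
  size k. This crude count bounds the number of bad sets in
  \<open>dependent_choice_color\<close>.\<close>

lemma card_bounded_subsets_le:
  assumes "finite A"
  shows "card {K. K \<subseteq> A \<and> card K \<le> k} \<le> (card A + 1) ^ k"
proof (induction k)
  case 0
  have "{K. K \<subseteq> A \<and> card K \<le> 0} = {{}}" using assms by (auto dest: finite_subset)
  then show ?case by simp
next
  case (Suc k)
  let ?S = "\<lambda>k. {K. K \<subseteq> A \<and> card K \<le> k}"
  have fin: "finite (?S k)" using assms by (auto intro: finite_subset[of _ "Pow A"])
  have "?S (Suc k) \<subseteq> ?S k \<union> (\<lambda>(a, K). insert a K) ` (A \<times> ?S k)"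
  proof
    fix K assume K: "K \<in> ?S (Suc k)"
    show "K \<in> ?S k \<union> (\<lambda>(a, K). insert a K) ` (A \<times> ?S k)"
    proof (cases "card K \<le> k")
      case False
      then have "K \<noteq> {}" by auto
      then obtain a where a: "a \<in> K" by blast
      have "(a, K - {a}) \<in> A \<times> ?S k"
        using a K False finite_subset[OF _ assms, of K] by (auto simp: card_Diff_singleton)
      moreover have "K = (\<lambda>(a, K). insert a K) (a, K - {a})"
        using a by (simp add: insert_absorb)
      ultimately show ?thesis by blast
    qed (use K in auto)
  qed
  then have "card (?S (Suc k)) \<le> card (?S k \<union> (\<lambda>(a, K). insert a K) ` (A \<times> ?S k))"
    using fin assms by (intro card_mono) auto
  also have "\<dots> \<le> card (?S k) + card ((\<lambda>(a, K). insert a K) ` (A \<times> ?S k))" by (rule card_Un_le)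
  also have "\<dots> \<le> card (?S k) + card A * card (?S k)"
    using card_image_le[of "A \<times> ?S k" "\<lambda>(a, K). insert a K"] fin assms
    by (simp only: card_cartesian_product finite_cartesian_product add_le_cancel_left)
  also have "\<dots> = (card A + 1) * card (?S k)" by simp
  also have "\<dots> \<le> (card A + 1) ^ Suc k" unfolding power_Suc by (rule mult_left_mono[OF Suc]) simp
  finally show ?case .
qed

text \<open>First moment over a uniform \<open>b\<close> in \<open>B\<close>: by
  \<open>dense\<close> the expected number of survivors is at least half of \<open>X\<close>, and by
  \<open>bad\<close> each set of \<open>F\<close> survives with probability at most 1 / 2^d. Some
  \<open>b\<close> does at least as well as the average.\<close>

lemma dependent_choice_step:
  fixes C :: real
  assumes "finite X" "finite B" "B \<noteq> {}" "finite F" "0 \<le> C"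
    and dense: "\<And>a. a \<in> X \<Longrightarrow> card B \<le> 2 * card {b \<in> B. P a b}"
    and bad: "\<And>K. K \<in> F \<Longrightarrow> 2 ^ d * card {b \<in> B. \<forall>a\<in>K. P a b} \<le> card B"
  shows "\<exists>b\<in>B. card X / 2 - C / 2 ^ d * card F
           \<le> card {a \<in> X. P a b} - C * card {K \<in> F. \<forall>a\<in>K. P a b}"
proof (rule ccontr)
  assume "\<not> ?thesis"
  then have "(\<Sum>b\<in>B. real (card {a \<in> X. P a b}) - C * card {K \<in> F. \<forall>a\<in>K. P a b})
             < (\<Sum>b\<in>B. card X / 2 - C / 2 ^ d * card F)"
    using assms(2,3) by (intro sum_strict_mono) (auto simp: not_le)
  also have "\<dots> = card B * (card X / 2) - C * (card F * (card B / 2 ^ d))"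
    by (simp add: algebra_simps)
  finally have "(\<Sum>b\<in>B. real (card {a \<in> X. P a b})) - C * (\<Sum>b\<in>B. real (card {K \<in> F. \<forall>a\<in>K. P a b}))
      < card B * (card X / 2) - C * (card F * (card B / 2 ^ d))"
    by (simp add: sum_subtractf flip: sum_distrib_left)
  moreover have "(\<Sum>b\<in>B. real (card {a \<in> X. P a b})) = (\<Sum>a\<in>X. real (card {b \<in> B. P a b}))"
    using sum.swap_restrict[of B X "\<lambda>_ _. 1::nat" "\<lambda>b a. P a b"] assms(1,2)
    by (simp flip: of_nat_sum)
  moreover have "(\<Sum>b\<in>B. real (card {K \<in> F. \<forall>a\<in>K. P a b})) = (\<Sum>K\<in>F. real (card {b \<in> B. \<forall>a\<in>K. P a b}))"
    using sum.swap_restrict[of B F "\<lambda>_ _. 1::nat" "\<lambda>b K. \<forall>a\<in>K. P a b"] assms(2,4)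
    by (simp flip: of_nat_sum)
  moreover have "(\<Sum>a\<in>X. real (card {b \<in> B. P a b})) \<ge> (\<Sum>a\<in>X. card B / 2)"
  proof (rule sum_mono)
    fix a assume "a \<in> X"
    from dense[OF this] show "card B / 2 \<le> card {b \<in> B. P a b}" by linarith
  qed
  moreover have "C * (\<Sum>K\<in>F. real (card {b \<in> B. \<forall>a\<in>K. P a b})) \<le> C * (\<Sum>K\<in>F. card B / 2 ^ d)"
  proof (intro mult_left_mono sum_mono)
    fix K assume "K \<in> F"
    from bad[OF this] have "real (2 ^ d * card {b \<in> B. \<forall>a\<in>K. P a b}) \<le> card B"
      by (simp only: of_nat_le_iff)
    then show "real (card {b \<in> B. \<forall>a\<in>K. P a b}) \<le> card B / 2 ^ d"
      by (simp add: field_simps)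
  qed fact
  ultimately show False by (simp add: mult.commute)
qed

text \<open>The vertices are chosen one at a time, each by averaging, so that the potential
  \<open>card X - C * #(bad sets inside X)\<close> loses at most a factor 2 per step while the coefficient of the
  initial number of bad sets shrinks by \<open>2 ^ d\<close>.\<close>

lemma dependent_choice_iterate:
  fixes C :: real
  assumes "finite A" "finite B" "B \<noteq> {}" "finite F" "0 \<le> C"
    and dense: "\<And>a. a \<in> A \<Longrightarrow> card B \<le> 2 * card {b \<in> B. P a b}"
    and bad: "\<And>K. K \<in> F \<Longrightarrow> 2 ^ Suc d * card {b \<in> B. \<forall>a\<in>K. P a b} \<le> card B"
    and F: "\<And>K. K \<in> F \<Longrightarrow> K \<subseteq> A"
  shows "\<exists>X\<subseteq>A. (card A - C / 2 ^ (d * t) * card F) / 2 ^ t \<le> card X - C * card {K \<in> F. K \<subseteq> X}"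
  using \<open>0 \<le> C\<close>
proof (induction t arbitrary: C)
  case 0
  have "{K \<in> F. K \<subseteq> A} = F" using F by blast
  then show ?case by (intro exI[of _ A]) simp
next
  case (Suc t)
  \<comment> \<open>The induction hypothesis is taken at \<open>C / 2 ^ d\<close>. Badness holds
    with exponent \<open>Suc d\<close>, so one more step cuts the bad term by 2^(d+1): one factor 2
    matches the halving of \<open>X\<close>, the other 2^d restores the coefficient
    \<open>C\<close>.\<close>
  then obtain X where X: "X \<subseteq> A"
    "(card A - C / 2 ^ d / 2 ^ (d * t) * card F) / 2 ^ t \<le> card X - C / 2 ^ d * card {K \<in> F. K \<subseteq> X}"
    by (meson divide_nonneg_nonneg zero_le_numeral zero_le_power)
  have "\<exists>b\<in>B. card X / 2 - C / 2 ^ Suc d * card {K \<in> F. K \<subseteq> X}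
         \<le> card {a \<in> X. P a b} - C * card {K \<in> {K \<in> F. K \<subseteq> X}. \<forall>a\<in>K. P a b}"
    using X(1) assms Suc.prems by (intro dependent_choice_step) (auto intro: finite_subset)
  then obtain b where b: "card X / 2 - C / 2 ^ Suc d * card {K \<in> F. K \<subseteq> X}
         \<le> card {a \<in> X. P a b} - C * card {K \<in> {K \<in> F. K \<subseteq> X}. \<forall>a\<in>K. P a b}" by blast
  have eq: "{K \<in> {K \<in> F. K \<subseteq> X}. \<forall>a\<in>K. P a b} = {K \<in> F. K \<subseteq> {a \<in> X. P a b}}" by blast
  have "(card A - C / 2 ^ (d * Suc t) * card F) / 2 ^ Suc t
     = (card A - C / 2 ^ d / 2 ^ (d * t) * card F) / 2 ^ t / 2"
    by (simp add: power_add)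
  also have "\<dots> \<le> (card X - C / 2 ^ d * card {K \<in> F. K \<subseteq> X}) / 2"
    using X(2) by (rule divide_right_mono) simp
  also have "\<dots> = card X / 2 - C / 2 ^ Suc d * card {K \<in> F. K \<subseteq> X}"
    by (simp add: diff_divide_distrib)
  finally show ?case using b X(1) unfolding eq by (intro exI[of _ "{a \<in> X. P a b}"]) auto
qed

text \<open>Iterate with \<open>C = card A\<close>. By \<open>few\<close> the final potential is at
  least card A / 2^(t+1) > 0, whereas a single surviving bad set would already push it down to at
  most card X - card A <= 0.\<close>

lemma dependent_choice:
  assumes "finite A" "finite B" "finite F"
    and dense: "\<And>a. a \<in> A \<Longrightarrow> card B \<le> 2 * card {b \<in> B. P a b}"
    and bad: "\<And>K. K \<in> F \<Longrightarrow> 2 ^ Suc d * card {b \<in> B. \<forall>a\<in>K. P a b} < card B"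
    and F: "\<And>K. K \<in> F \<Longrightarrow> K \<subseteq> A"
    and few: "2 * card F \<le> 2 ^ (d * t)"
  shows "\<exists>X\<subseteq>A. card A \<le> 2 ^ Suc t * card X \<and> (\<forall>K\<in>F. \<not> K \<subseteq> X)"
proof (cases "A = {} \<or> B = {}")
  case True
  then show ?thesis
  proof
    assume A: "A = {}"
    show ?thesis
    proof (cases "F = {}")
      \<comment> \<open>The only possible member of \<open>F\<close> is now the empty set, whose
        common neighborhood is all of \<open>B\<close>, so it cannot be bad.\<close>
      case False
      then obtain K where "K \<in> F" by blast
      with bad[OF this] F[OF this] A show ?thesis by (simp add: less_le_trans)
    qed (use A in auto)
  next
    assume "B = {}"
    then have "F = {}" using bad by fastforce
    then show ?thesis by (intro exI[of _ A]) auto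
  qed
next
  case False
  then have A: "0 < card A" using assms by (simp add: card_gt_0_iff)
  have "\<exists>X\<subseteq>A. (card A - real (card A) / 2 ^ (d * t) * card F) / 2 ^ t
          \<le> card X - real (card A) * card {K \<in> F. K \<subseteq> X}"
    using assms(1-4) False F less_imp_le[OF bad]
    by (intro dependent_choice_iterate[where B = B and P = P]) auto
  then obtain X where X: "X \<subseteq> A"
    "(card A - card A / 2 ^ (d * t) * card F) / 2 ^ t \<le> card X - real (card A) * card {K \<in> F. K \<subseteq> X}"
    by blast
  have "real (2 * card F) \<le> real (2 ^ (d * t))" using few by (simp only: of_nat_le_iff)
  then have "real (card A) * (card F / 2 ^ (d * t)) \<le> card A * (1 / 2)"
    by (intro mult_left_mono) (auto simp: field_simps)
  then have le: "card A / 2 ^ Suc t \<le> (card A - card A / 2 ^ (d * t) * card F) / 2 ^ t"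
    by (simp add: field_simps)
  have none: "{K \<in> F. K \<subseteq> X} = {}"
  proof (rule ccontr)
    assume "{K \<in> F. K \<subseteq> X} \<noteq> {}"
    then have "1 \<le> card {K \<in> F. K \<subseteq> X}" using assms(3) by (simp add: Suc_le_eq card_gt_0_iff)
    then have "real (card A) * 1 \<le> real (card A) * card {K \<in> F. K \<subseteq> X}"
      by (intro mult_left_mono) auto
    moreover have "card X \<le> card A" using X(1) assms(1) by (simp add: card_mono)
    moreover have "0 < card A / 2 ^ Suc t" using A by simp
    ultimately show False using X(2) le by linarith
  qed
  have "card A / 2 ^ Suc t \<le> card X"
    using order_trans[OF le X(2)] unfolding none by simp
  then have "real (card A) \<le> real (2 ^ Suc t * card X)" by (simp add: field_simps)
  then have "card A \<le> 2 ^ Suc t * card X" by (simp only: of_nat_le_iff)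
  then show ?thesis using X(1) none by blast
qed

text \<open>Each vertex of \<open>A\<close> sees at least half of \<open>B\<close> in one of the
  colors; keeping the vertices of the more popular color loses a factor 2, whence t + 2 instead of t
  + 1. The sets to be avoided are those of size at most \<open>k\<close> with too few common
  neighbors in that color.\<close>

lemma dependent_choice_color:
  fixes c :: "'a set \<Rightarrow> color"
  assumes fin: "finite A" "finite B" and few: "2 * (card A + 1) ^ k \<le> 2 ^ (d * t)"
  shows "\<exists>X\<subseteq>A. \<exists>col. card A \<le> 2 ^ (t + 2) * card X \<and>
           (\<forall>K\<subseteq>X. card K \<le> k \<longrightarrow> card B \<le> 2 ^ Suc d * card {b \<in> B. \<forall>a\<in>K. c {a, b} = col})"
proof -
  define A' where "A' = (\<lambda>col. {a \<in> A. card B \<le> 2 * card {b \<in> B. c {a, b} = col}})"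
  have cover: "A \<subseteq> A' Red \<union> A' Blue"
  proof
    fix a assume "a \<in> A"
    have "{b \<in> B. c {a, b} = Red} \<union> {b \<in> B. c {a, b} = Blue} = B"
      using color_neq_iff by blast
    with card_Un_le[of "{b \<in> B. c {a, b} = Red}" "{b \<in> B. c {a, b} = Blue}"]
    have "card B \<le> card {b \<in> B. c {a, b} = Red} + card {b \<in> B. c {a, b} = Blue}"
      by (simp only:)
    then show "a \<in> A' Red \<union> A' Blue" using \<open>a \<in> A\<close> unfolding A'_def by auto
  qed
  have finA': "finite (A' col)" for col using fin by (simp add: A'_def)
  have "card A \<le> card (A' Red) + card (A' Blue)"
    using card_mono[OF _ cover] card_Un_le[of "A' Red" "A' Blue"] finA' by (meson finite_UnI le_trans)
  then have "card A \<le> 2 * card (A' Red) \<or> card A \<le> 2 * card (A' Blue)" by linarith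
  then obtain col where col: "card A \<le> 2 * card (A' col)" by blast
  have A'A: "A' col \<subseteq> A" by (auto simp: A'_def)
  define F where "F = {K. K \<subseteq> A' col \<and> card K \<le> k \<and> 2 ^ Suc d * card {b \<in> B. \<forall>a\<in>K. c {a, b} = col} < card B}"
  have sub: "F \<subseteq> {K. K \<subseteq> A \<and> card K \<le> k}" using A'A by (auto simp: F_def)
  have "finite {K. K \<subseteq> A \<and> card K \<le> k}" using fin by simp
  then have "card F \<le> card {K. K \<subseteq> A \<and> card K \<le> k}" "finite F"
    using sub by (auto intro: card_mono finite_subset)
  then have few': "2 * card F \<le> 2 ^ (d * t)" using card_bounded_subsets_le[OF fin(1), of k] few by linarith
  have "\<exists>X\<subseteq>A' col. card (A' col) \<le> 2 ^ Suc t * card X \<and> (\<forall>K\<in>F. \<not> K \<subseteq> X)"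
    by (rule dependent_choice[where P = "\<lambda>a b. c {a, b} = col" and B = B and d = d])
      (use \<open>finite F\<close> finA' fin(2) few' in \<open>auto simp: F_def A'_def\<close>)
  then obtain X where X: "X \<subseteq> A' col" "card (A' col) \<le> 2 ^ Suc t * card X" "\<forall>K\<in>F. \<not> K \<subseteq> X" by blast
  have "card A \<le> 2 ^ (t + 2) * card X" using col X(2) by simp
  moreover have "card B \<le> 2 ^ Suc d * card {b \<in> B. \<forall>a\<in>K. c {a, b} = col}" if "K \<subseteq> X" "card K \<le> k" for K
  proof (rule ccontr)
    assume "\<not> ?thesis"
    then have "K \<in> F" using that X(1) unfolding F_def by (auto simp: not_le)
    then show False using X(3) that(1) by blast
  qed
  ultimately show ?thesis using X(1) A'A by blast
qed

text \<open>The sets \<open>B j\<close> are treated one after another. What was achieved for earlier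
  ones concerns all small subsets of \<open>X\<close>, so it survives further shrinking.\<close>

lemma dependent_choice_colors:
  fixes c :: "'a set \<Rightarrow> color"
  assumes "finite J" and fin: "finite A" "\<And>j. j \<in> J \<Longrightarrow> finite (B j)"
    and few: "2 * (card A + 1) ^ k \<le> 2 ^ (d * t)"
  shows "\<exists>X\<subseteq>A. \<exists>\<chi>. card A \<le> 2 ^ ((t + 2) * card J) * card X \<and>
           (\<forall>j\<in>J. \<forall>K\<subseteq>X. card K \<le> k \<longrightarrow>
              card (B j) \<le> 2 ^ Suc d * card {b \<in> B j. \<forall>a\<in>K. c {a, b} = \<chi> j})"
  using assms(1) fin(2)
proof (induction J rule: finite_induct)
  case empty
  show ?case by (rule exI[of _ A]) simp
next
  case (insert i J)
  have "\<exists>X\<subseteq>A. \<exists>\<chi>. card A \<le> 2 ^ ((t + 2) * card J) * card X \<and>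
           (\<forall>j\<in>J. \<forall>K\<subseteq>X. card K \<le> k \<longrightarrow>
              card (B j) \<le> 2 ^ Suc d * card {b \<in> B j. \<forall>a\<in>K. c {a, b} = \<chi> j})"
    by (rule insert.IH) (use insert.prems in simp)
  then obtain X \<chi> where X: "X \<subseteq> A" "card A \<le> 2 ^ ((t + 2) * card J) * card X"
    and \<chi>: "\<forall>j\<in>J. \<forall>K\<subseteq>X. card K \<le> k \<longrightarrow>
       card (B j) \<le> 2 ^ Suc d * card {b \<in> B j. \<forall>a\<in>K. c {a, b} = \<chi> j}"
    by (elim exE conjE)
  have "finite X" "finite (B i)" using finite_subset[OF X(1) fin(1)] insert.prems by auto
  have "(card X + 1) ^ k \<le> (card A + 1) ^ k"
    using X(1) fin(1) by (intro power_mono) (auto intro: card_mono)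
  then have "2 * (card X + 1) ^ k \<le> 2 ^ (d * t)" using few by linarith
  from dependent_choice_color[OF \<open>finite X\<close> \<open>finite (B i)\<close> this]
  have "\<exists>X'\<subseteq>X. \<exists>col. card X \<le> 2 ^ (t + 2) * card X' \<and>
           (\<forall>K\<subseteq>X'. card K \<le> k \<longrightarrow> card (B i) \<le> 2 ^ Suc d * card {b \<in> B i. \<forall>a\<in>K. c {a, b} = col})" .
  then obtain X' col where X': "X' \<subseteq> X" "card X \<le> 2 ^ (t + 2) * card X'"
    and col: "\<forall>K\<subseteq>X'. card K \<le> k \<longrightarrow> card (B i) \<le> 2 ^ Suc d * card {b \<in> B i. \<forall>a\<in>K. c {a, b} = col}"
    by (elim exE conjE)
  have "card A \<le> 2 ^ ((t + 2) * card J) * (2 ^ (t + 2) * card X')"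
    using X(2) X'(2) by (meson le_trans mult_le_mono2)
  also have "\<dots> = 2 ^ ((t + 2) * card (insert i J)) * card X'"
    using insert.hyps by (simp add: power_add)
  finally have "card A \<le> 2 ^ ((t + 2) * card (insert i J)) * card X'" .
  moreover have "card (B j) \<le> 2 ^ Suc d * card {b \<in> B j. \<forall>a\<in>K. c {a, b} = (\<chi>(i := col)) j}"
    if "j \<in> insert i J" "K \<subseteq> X'" "card K \<le> k" for j K
  proof (cases "j = i")
    case True
    with col that show ?thesis by simp
  next
    case False
    with that have "j \<in> J" "K \<subseteq> X" using X'(1) by auto
    with \<chi> that(3) show ?thesis using False by simp
  qed
  moreover have "X' \<subseteq> A" using X' X by blast
  ultimately show ?case by blast
qed

section \<open>The lower bound\<close>

text \<open>The parameters: \<open>2 * l j\<close> bounds the logarithms of the vertices of block \<open>j\<close>; processing block \<open>j\<close>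
  takes \<open>t j\<close> rounds of dependent random choice against each later block, leaves at least \<open>2 ^ l j\<close>
  of its vertices, and costs each later block a factor \<open>2 ^ Suc (d j)\<close>.\<close>

lemma card_le_exp_clique_weights:
  fixes c :: "'a set \<Rightarrow> color" and w :: "'a \<Rightarrow> real" and B :: "nat \<Rightarrow> 'a set"
    and l t d :: "nat \<Rightarrow> nat"
  assumes "finite J" "card J \<le> M"
    and "\<And>j. j \<in> J \<Longrightarrow> finite (B j)"
    and "\<And>i j. i \<in> J \<Longrightarrow> j \<in> J \<Longrightarrow> i \<noteq> j \<Longrightarrow> B i \<inter> B j = {}"
    and "\<And>j. j \<in> J \<Longrightarrow> 0 < l j"
    and "\<And>j. j \<in> J \<Longrightarrow> card (B j) < 2 ^ (2 * l j)"
    and "\<And>j v. j \<in> J \<Longrightarrow> v \<in> B j \<Longrightarrow> 1 / (2 * l j) \<le> w v"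
    and "\<And>j. j \<in> J \<Longrightarrow> 2 * l j * (4 * M * l j) + 1 \<le> d j * t j"
    and "\<And>j. j \<in> J \<Longrightarrow> 2 ^ (l j + (t j + 2) * M + (\<Sum>i | i \<in> J \<and> i < j. Suc (d i))) \<le> card (B j)"
    and "X \<le> M" "Y \<le> M"
    and "\<And>S. S \<subseteq> \<Union> (B ` J) \<Longrightarrow> monochromatic c Red S \<Longrightarrow> sum w S \<le> X"
    and "\<And>S. S \<subseteq> \<Union> (B ` J) \<Longrightarrow> monochromatic c Blue S \<Longrightarrow> sum w S \<le> Y"
  shows "card J + 1 \<le> exp (8 * (X + Y))"
  using assms
proof (induction J arbitrary: B X Y rule: finite_psubset_induct)
  case (psubset J)
  note M = psubset.prems(1) and fin = psubset.prems(2) and disj = psubset.prems(3)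
    and lpos = psubset.prems(4) and small = psubset.prems(5) and weight = psubset.prems(6)
    and params = psubset.prems(7) and large = psubset.prems(8)
    and XM = psubset.prems(9) and YM = psubset.prems(10)
    and red = psubset.prems(11) and blue = psubset.prems(12)
  show ?case
  proof (cases "J = {}")
    case True
    have "0 \<le> X" "0 \<le> Y" using red[of "{}"] blue[of "{}"] by simp_all
    then show ?thesis using True by simp
  next
    case False
    \<comment> \<open>The smallest index goes first, since the size hypothesis of every later block
      holds \<open>Suc (d i)\<close> in reserve.\<close>
    define i where "i = Min J"
    have i: "i \<in> J" "\<And>j. j \<in> J \<Longrightarrow> i \<le> j"
      using psubset.hyps False by (auto simp: i_def)
    define J' where "J' = J - {i}"
    \<comment> \<open>A clique of weight at most \<open>M\<close> in block \<open>i\<close> has at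
      most 2 M l_i vertices; \<open>k\<close> accommodates a red and a blue one together.\<close>
    define k where "k = 4 * M * l i"
    have J': "finite J'" "card J = card J' + 1" "i \<notin> J'" "J' \<subseteq> J"
      using psubset.hyps i(1) card_Suc_Diff1[of J i] by (auto simp: J'_def)
    have "(card (B i) + 1) ^ k \<le> (2 ^ (2 * l i)) ^ k"
      using small[OF i(1)] by (intro power_mono) auto
    then have "2 * (card (B i) + 1) ^ k \<le> 2 ^ (2 * l i * k + 1)"
      by (simp add: power_mult)
    also have "(2::nat) ^ (2 * l i * k + 1) \<le> 2 ^ (d i * t i)"
      using params[OF i(1)] unfolding k_def by (intro power_increasing) auto
    finally have few: "2 * (card (B i) + 1) ^ k \<le> 2 ^ (d i * t i)" .
    have finJ': "finite (B j)" if "j \<in> J'" for j using fin J'(4) that by blast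
    have "\<exists>A\<subseteq>B i. \<exists>\<chi>. card (B i) \<le> 2 ^ ((t i + 2) * card J') * card A \<and>
           (\<forall>j\<in>J'. \<forall>K\<subseteq>A. card K \<le> k \<longrightarrow>
              card (B j) \<le> 2 ^ Suc (d i) * card {b \<in> B j. \<forall>a\<in>K. c {a, b} = \<chi> j})"
      by (rule dependent_choice_colors[OF J'(1) fin[OF i(1)] finJ' few])
    then obtain A \<chi> where A: "A \<subseteq> B i" "card (B i) \<le> 2 ^ ((t i + 2) * card J') * card A"
      and \<chi>: "\<forall>j\<in>J'. \<forall>K\<subseteq>A. card K \<le> k \<longrightarrow>
             card (B j) \<le> 2 ^ Suc (d i) * card {b \<in> B j. \<forall>a\<in>K. c {a, b} = \<chi> j}"
      by (elim exE conjE)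
    have finA: "finite A" using A(1) fin[OF i(1)] by (rule finite_subset)
    have "2 ^ l i \<le> card A"
    proof -
      have "2 ^ ((t i + 2) * M) * 2 ^ l i \<le> card (B i)"
        using order_trans[OF _ large[OF i(1)], of "2 ^ (l i + (t i + 2) * M)"]
        by (simp add: power_add mult.commute)
      also have "\<dots> \<le> 2 ^ ((t i + 2) * M) * card A"
        using A(2) M J'(2)
        by (elim order_trans) (intro mult_right_mono power_increasing mult_left_mono, auto)
      finally show ?thesis by simp
    qed
    then have bigA: "2 powr (real (2 * l i) / 2) \<le> card A"
      by (simp add: powr_realpow numeral_power_le_of_nat_cancel_iff)
    obtain KR where KR: "KR \<subseteq> A" "monochromatic c Red KR"
      "\<And>S. S \<subseteq> A \<Longrightarrow> monochromatic c Red S \<Longrightarrow> card S \<le> card KR"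
      using max_monochromatic[OF finA, of c Red] by blast
    obtain KB where KB: "KB \<subseteq> A" "monochromatic c Blue KB"
      "\<And>S. S \<subseteq> A \<Longrightarrow> monochromatic c Blue S \<Longrightarrow> card S \<le> card KB"
      using max_monochromatic[OF finA, of c Blue] by blast
    \<comment> \<open>These are lower bounds for the clique weights, in the form in which the
      trade-off with L = 2 l_i applies.\<close>
    define r b where "r = card KR / real (2 * l i)" and "b = card KB / real (2 * l i)"
    have rb: "exp (- (8 * r)) + exp (- (8 * b)) \<le> 1"
      unfolding r_def b_def using lpos[OF i(1)] bigA KR(3) KB(3) finA
      by (intro clique_sizes_tradeoff[where A = A and c = c]) auto
    have weightK: "card K / real (2 * l i) \<le> sum w K" if "K \<subseteq> A" for K
    proof -
      have "(\<Sum>v\<in>K. 1 / real (2 * l i)) \<le> sum w K"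
        using weight[OF i(1)] that A(1) by (intro sum_mono) auto
      then show ?thesis by simp
    qed
    have sumKR: "r \<le> sum w KR" and sumKB: "b \<le> sum w KB"
      unfolding r_def b_def by (intro weightK KR(1) KB(1))+
    have "A \<subseteq> \<Union> (B ` J)" using A(1) i(1) by blast
    then have "sum w KR \<le> X" "sum w KB \<le> Y" using red[of KR] blue[of KB] KR KB by auto
    then have "r \<le> M" "b \<le> M" using sumKR sumKB XM YM by linarith+
    then have "real (card KR) \<le> real (M * (2 * l i))" "real (card KB) \<le> real (M * (2 * l i))"
      using lpos[OF i(1)] unfolding r_def b_def by (simp_all add: field_simps)
    then have "card KR \<le> M * (2 * l i)" "card KB \<le> M * (2 * l i)"
      by (simp_all only: of_nat_le_iff)
    then have "card (KR \<union> KB) \<le> k" unfolding k_def using card_Un_le[of KR KB] by linarith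
    define B' where "B' = (\<lambda>j. {b \<in> B j. \<forall>a\<in>KR \<union> KB. c {a, b} = \<chi> j})"
    have B'B: "B' j \<subseteq> B j" for j by (auto simp: B'_def)
    have dense: "card (B j) \<le> 2 ^ Suc (d i) * card (B' j)" if "j \<in> J'" for j
      using \<chi> that KR(1) KB(1) \<open>card (KR \<union> KB) \<le> k\<close> unfolding B'_def by (meson Un_least)
    \<comment> \<open>Passing to \<open>B' j\<close> costs the factor \<open>2 ^ Suc (d i)\<close>,
      and exactly this summand leaves the exponent, because \<open>i\<close> is not in
      \<open>J''\<close>.\<close>
    have large': "2 ^ (l j + (t j + 2) * M + (\<Sum>i | i \<in> J'' \<and> i < j. Suc (d i))) \<le> card (B' j)"
      if "J'' \<subseteq> J'" "j \<in> J''" for J'' j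
    proof -
      have "i < j" "j \<in> J" using that i(2) J'(3,4) by (metis le_neq_implies_less subset_iff)+
      have "Suc (d i) + (\<Sum>i | i \<in> J'' \<and> i < j. Suc (d i)) = (\<Sum>i\<in>insert i {i \<in> J''. i < j}. Suc (d i))"
        using that(1) J'(1,3) by (subst sum.insert) (auto intro: finite_subset)
      also have "\<dots> \<le> (\<Sum>i | i \<in> J \<and> i < j. Suc (d i))"
        using that(1) J'(4) i(1) \<open>i < j\<close> psubset.hyps by (intro sum_mono2) auto
      finally have "(2::nat) ^ (Suc (d i) + (l j + (t j + 2) * M + (\<Sum>i | i \<in> J'' \<and> i < j. Suc (d i))))
          \<le> 2 ^ (l j + (t j + 2) * M + (\<Sum>i | i \<in> J \<and> i < j. Suc (d i)))"
        by (intro power_increasing) auto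
      also have "\<dots> \<le> card (B j)" by (rule large) fact
      also have "\<dots> \<le> 2 ^ Suc (d i) * card (B' j)" using dense that by blast
      finally show ?thesis unfolding power_add[of _ "Suc (d i)"] by (simp only: mult_le_cancel1) simp
    qed
    have sumS: "sum w (S \<union> K) = sum w S + sum w K" if "S \<subseteq> \<Union> (B' ` J'')" "J'' \<subseteq> J'" "K \<subseteq> A" for S K J''
    proof (rule sum.union_disjoint)
      have "S \<subseteq> \<Union> (B ` J')" using that(1,2) B'B by fastforce
      then show "finite S" by (rule finite_subset) (use J'(1) finJ' in blast)
      show "finite K" using that(3) finA by (rule finite_subset)
      show "S \<inter> K = {}"
        using \<open>S \<subseteq> \<Union> (B ` J')\<close> that(3) A(1) disj[OF i(1)] J'(3,4) by fastforce
    qed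
    have IH: "card J'' + 1 \<le> exp (8 * (X' + Y'))" if J'': "J'' \<subseteq> J'" and XY: "X' \<le> X" "Y' \<le> Y"
      and red': "\<And>S. S \<subseteq> \<Union> (B' ` J'') \<Longrightarrow> monochromatic c Red S \<Longrightarrow> sum w S \<le> X'"
      and blue': "\<And>S. S \<subseteq> \<Union> (B' ` J'') \<Longrightarrow> monochromatic c Blue S \<Longrightarrow> sum w S \<le> Y'"
      for J'' X' Y'
    proof (rule psubset.IH[where Ba = B'])
      show "J'' \<subset> J" using J'' J'(3,4) i(1) by blast
      show "card J'' \<le> M" using card_mono[OF J'(1) J''] J'(2) M by linarith
      show "X' \<le> M" "Y' \<le> M" using XY XM YM by linarith+
    next
      fix j assume "j \<in> J''"
      then have j: "j \<in> J" using J'' J'(4) by blast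
      show "finite (B' j)" using fin[OF j] B'B by (rule finite_subset[rotated])
      show "0 < l j" using lpos[OF j] .
      show "card (B' j) < 2 ^ (2 * l j)" using small[OF j] card_mono[OF fin[OF j] B'B] by linarith
      show "1 / (2 * l j) \<le> w v" if "v \<in> B' j" for v using weight[OF j] that B'B by blast
      show "2 * l j * (4 * M * l j) + 1 \<le> d j * t j" using params[OF j] .
      show "2 ^ (l j + (t j + 2) * M + (\<Sum>i | i \<in> J'' \<and> i < j. Suc (d i))) \<le> card (B' j)"
        using large'[OF J'' \<open>j \<in> J''\<close>] .
      show "B' j \<inter> B' j' = {}" if "j' \<in> J''" "j \<noteq> j'" for j'
      proof -
        have "j' \<in> J" using that(1) J'' J'(4) by blast
        from disj[OF j this that(2)] show ?thesis using B'B by blast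
      qed
    qed (fact red' blue')+
    \<comment> \<open>Every vertex of the blocks in \<open>JR\<close> is joined in red to all of
      \<open>KR\<close>, so there a red clique can absorb \<open>KR\<close> and its budget drops by
      \<open>r\<close> while the blue budget stays. \<open>JB\<close> is symmetric.\<close>
    define JR where "JR = {j \<in> J'. \<chi> j = Red}"
    define JB where "JB = {j \<in> J'. \<chi> j = Blue}"
    have "J' = JR \<union> JB" "JR \<inter> JB = {}" using color_neq_iff by (auto simp: JR_def JB_def)
    then have cardJ': "card J' = card JR + card JB"
      using J'(1) by (metis card_Un_disjoint finite_Un)
    have sub: "\<Union> (B' ` J'') \<subseteq> \<Union> (B ` J)" if "J'' \<subseteq> J'" for J''
      using that J'(4) B'B by fastforce
    have "0 \<le> r" "0 \<le> b" unfolding r_def b_def by simp_all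
    have R: "card JR + 1 \<le> exp (8 * ((X - r) + Y))"
    proof (rule IH)
      show JR: "JR \<subseteq> J'" by (auto simp: JR_def)
      fix S assume S: "S \<subseteq> \<Union> (B' ` JR)"
      then have SJ: "S \<subseteq> \<Union> (B ` J)" using sub[OF JR] by blast
      { assume "monochromatic c Blue S"
        then show "sum w S \<le> Y" using blue[OF SJ] by blast }
      assume mono: "monochromatic c Red S"
      have "c {x, y} = Red" if "x \<in> KR" "y \<in> S" for x y
        using that S by (force simp: B'_def JR_def)
      then have "monochromatic c Red (S \<union> KR)"
        using monochromatic_Un[OF KR(2) mono] by (simp add: Un_commute)
      moreover have "S \<union> KR \<subseteq> \<Union> (B ` J)" using SJ KR(1) A(1) i(1) by blast
      ultimately have "sum w (S \<union> KR) \<le> X" using red by blast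
      then show "sum w S \<le> X - r" using sumS[OF S JR KR(1)] sumKR by linarith
    qed (use \<open>0 \<le> r\<close> in simp_all)
    have B: "card JB + 1 \<le> exp (8 * (X + (Y - b)))"
    proof (rule IH)
      show JB: "JB \<subseteq> J'" by (auto simp: JB_def)
      fix S assume S: "S \<subseteq> \<Union> (B' ` JB)"
      then have SJ: "S \<subseteq> \<Union> (B ` J)" using sub[OF JB] by blast
      { assume "monochromatic c Red S"
        then show "sum w S \<le> X" using red[OF SJ] by blast }
      assume mono: "monochromatic c Blue S"
      have "c {x, y} = Blue" if "x \<in> KB" "y \<in> S" for x y
        using that S by (force simp: B'_def JB_def)
      then have "monochromatic c Blue (S \<union> KB)"
        using monochromatic_Un[OF KB(2) mono] by (simp add: Un_commute)
      moreover have "S \<union> KB \<subseteq> \<Union> (B ` J)" using SJ KB(1) A(1) i(1) by blast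
      ultimately have "sum w (S \<union> KB) \<le> Y" using blue by blast
      then show "sum w S \<le> Y - b" using sumS[OF S JB KB(1)] sumKB by linarith
    qed (use \<open>0 \<le> b\<close> in simp_all)
    \<comment> \<open>The recombination of \<open>weighted_Erdos_Szekeres\<close>, with the block
      \<open>i\<close> in the role of the vertex \<open>v\<close>.\<close>
    have "card J + 1 \<le> exp (8 * ((X - r) + Y)) + exp (8 * (X + (Y - b)))"
      using R B cardJ' J'(2) by simp
    also have "\<dots> = exp (8 * (X + Y)) * (exp (- (8 * r)) + exp (- (8 * b)))"
      by (simp add: algebra_simps flip: exp_add)
    also have "\<dots> \<le> exp (8 * (X + Y))" using mult_left_mono[OF rb, of "exp (8 * (X + Y))"] by simp
    finally show ?thesis .
  qed
qed

text \<open>The recursion is run on \<open>M\<close> blocks whose logarithms grow by the factor Q =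
  64 M^4. This ratio lets the shrinkage caused by all earlier blocks be absorbed by a fraction of
  the size of the current one.\<close>

lemma large_clique_weight:
  fixes c :: "nat set \<Rightarrow> color" and X :: real
  assumes M: "0 < M" and n: "2 ^ ((64 * M ^ 4) ^ M) \<le> n" and X: "X \<le> M"
    and light: "\<And>S col. S \<subseteq> {2..n} \<Longrightarrow> monochromatic c col S \<Longrightarrow> weight S \<le> X"
  shows "real M + 1 \<le> exp (16 * X)"
proof -
  define Q where "Q = 64 * M ^ 4"
  \<comment> \<open>With P = Q^(j-1): \<open>l j\<close> is half of Q^j, the rounds against at most
    \<open>M\<close> later blocks cost about 8 M^4 P = Q^j / 8, and \<open>d j\<close> is then as
    large as \<open>d j * t j\<close> requires. Since \<open>d\<close> carries only M^2, its sum
    over earlier blocks is O(M^3 P).\<close>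
  define l t d :: "nat \<Rightarrow> nat" where "l = (\<lambda>j. 32 * M ^ 4 * Q ^ (j - 1))"
    and "t = (\<lambda>j. 8 * M ^ 3 * Q ^ (j - 1))" and "d = (\<lambda>j. 17 * M ^ 2 * Q ^ j)"
  define B where "B = (\<lambda>j::nat. {2 ^ (Q ^ j - 1)<..2 ^ (Q ^ j)::nat})"
  have Q: "64 \<le> Q" using M by (simp add: Q_def)
  have l: "2 * l j = Q ^ j" if "1 \<le> j" for j
    using that by (cases j) (auto simp: l_def Q_def)
  have Qpos: "1 \<le> Q ^ j" for j using Q by simp
  have half: "2 * 2 ^ (Q ^ j - 1) = (2::nat) ^ Q ^ j" for j
    using Qpos[of j] by (metis One_nat_def Suc_pred less_eq_Suc_le power_Suc)
  have cardB: "card (B j) = 2 ^ (Q ^ j - 1)" for j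
    using half[of j] by (simp add: B_def)
  have "card {1..M} + 1 \<le> exp (8 * (X + X))"
  proof (rule card_le_exp_clique_weights[where c = c and w = "\<lambda>s. 1 / log 2 (real s)" and B = B
        and l = l and t = t and d = d and M = M])
    fix i j assume ij: "i \<in> {1..M}" "j \<in> {1..M}" "i \<noteq> j"
    have disj: "B i \<inter> B j = {}" if "i < j" for i j
    proof -
      have "Q ^ i < Q ^ j" using Q that by (intro power_strict_increasing) auto
      then have "(2::nat) ^ (Q ^ i) \<le> 2 ^ (Q ^ j - 1)" by (intro power_increasing) auto
      then show ?thesis by (auto simp: B_def)
    qed
    show "B i \<inter> B j = {}" using disj[of i j] disj[of j i] ij(3) by (cases i j rule: linorder_cases) auto
  next
    fix j assume j: "j \<in> {1..M}"
    then have l': "2 * l j = Q ^ j" using l by simp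
    define P where "P = Q ^ (j - 1)"
    have P: "Q ^ j = 64 * M ^ 4 * P" "1 \<le> P" using j Qpos[of "j - 1"]
      by (cases j; simp add: P_def Q_def)+
    show "0 < l j" using l' Qpos[of j] by simp
    show "finite (B j)" by (simp add: B_def)
    show "card (B j) < 2 ^ (2 * l j)" unfolding l' cardB half[of j, symmetric] by simp
    show "1 / (2 * l j) \<le> 1 / log 2 (real v)" if v: "v \<in> B j" for v
    proof -
      have "(1::nat) \<le> 2 ^ (Q ^ j - 1)" by simp
      also have "\<dots> < v" using v by (simp add: B_def)
      finally have "1 < v" .
      have "log 2 v \<le> log 2 (2 ^ (Q ^ j))"
        using v \<open>1 < v\<close> by (subst log_le_cancel_iff) (auto simp: B_def numeral_power_le_of_nat_cancel_iff of_nat_le_numeral_power_cancel_iff)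
      moreover have "0 < real (Q ^ j) * log 2 v"
        using \<open>1 < v\<close> Q by (intro mult_pos_pos) auto
      ultimately show ?thesis using \<open>1 < v\<close> unfolding l' by (intro divide_left_mono) (auto simp: log_nat_power)
    qed
    \<comment> \<open>In units of M^5 P Q^j the right side is 17 * 8 = 136 and the product on the
      left 128; the surplus 8 covers the summand 1.\<close>
    show "2 * l j * (4 * M * l j) + 1 \<le> d j * t j"
    proof -
      have "d j * t j = 136 * M * (M ^ 4 * P) * Q ^ j"
        unfolding d_def t_def P_def by (simp add: power2_eq_square power3_eq_cube power4_eq_xxxx)
      moreover have "2 * l j * (4 * M * l j) = 128 * M * (M ^ 4 * P) * Q ^ j"
        unfolding l' by (simp add: l_def P_def)
      moreover have "1 \<le> 8 * M * (M ^ 4 * P) * Q ^ j" using M P Qpos[of j] by (simp add: Suc_le_eq)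
      ultimately show ?thesis by linarith
    qed
    show "2 ^ (l j + (t j + 2) * M + (\<Sum>i | i \<in> {1..M} \<and> i < j. Suc (d i))) \<le> card (B j)"
      unfolding cardB
    proof (rule power_increasing)
      have "(\<Sum>i | i \<in> {1..M} \<and> i < j. Suc (d i)) \<le> (\<Sum>i | i \<in> {1..M} \<and> i < j. 18 * M ^ 2 * P)"
      proof (rule sum_mono)
        fix i assume i: "i \<in> {i \<in> {1..M}. i < j}"
        have "Q ^ i \<le> P" unfolding P_def using Q i by (intro power_increasing) auto
        then have "17 * M ^ 2 * Q ^ i \<le> 17 * M ^ 2 * P" by (rule mult_left_mono) simp
        moreover have "1 \<le> M ^ 2 * P" using M P by (simp add: Suc_le_eq)
        ultimately show "Suc (d i) \<le> 18 * M ^ 2 * P" unfolding d_def by linarith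
      qed
      also have "\<dots> = card {i \<in> {1..M}. i < j} * (18 * M ^ 2 * P)" by simp
      also have "\<dots> \<le> card {1..M} * (18 * M ^ 2 * P)"
        by (intro mult_right_mono card_mono) auto
      also have "\<dots> = 18 * (M ^ 3 * P)"
        by (simp add: power2_eq_square power3_eq_cube)
      also have "\<dots> \<le> 18 * (M ^ 4 * P)" using M by (simp add: power_increasing)
      finally have sum: "(\<Sum>i | i \<in> {1..M} \<and> i < j. Suc (d i)) \<le> 18 * (M ^ 4 * P)" .
      \<comment> \<open>Exponent budget in units of M^4 P: 32 for \<open>l j\<close>, 8 + 2 for the
        rounds and 18 for earlier blocks give 60, below the available 64 minus the 1 lost to the
        dyadic lower end.\<close>
      have "M \<le> M ^ 4" using M by (simp add: self_le_power)
      also have "\<dots> \<le> M ^ 4 * P" using P by simp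
      finally have "M \<le> M ^ 4 * P" .
      moreover have "(t j + 2) * M = 8 * (M ^ 4 * P) + 2 * M"
        by (simp add: t_def P_def algebra_simps power3_eq_cube power4_eq_xxxx)
      moreover have "l j = 32 * (M ^ 4 * P)" by (simp add: l_def P_def)
      ultimately show "l j + (t j + 2) * M + (\<Sum>i | i \<in> {1..M} \<and> i < j. Suc (d i)) \<le> Q ^ j - 1"
        using sum M unfolding P(1) by linarith
    qed simp
  next
    have B: "B j \<subseteq> {2..n}" if "j \<in> {1..M}" for j
    proof -
      have "Q ^ j \<le> Q ^ M" using Q that by (intro power_increasing) auto
      then have "(2::nat) ^ (Q ^ j) \<le> 2 ^ (Q ^ M)" by (rule power_increasing) simp
      also have "\<dots> \<le> n" using n by (simp add: Q_def)
      finally have "2 ^ (Q ^ j) \<le> n" .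
      moreover have "(0::nat) < 2 ^ (Q ^ j - 1)" by simp
      then have "2 \<le> v" if "2 ^ (Q ^ j - 1) < v" for v :: nat using that by linarith
      ultimately show ?thesis by (auto simp: B_def)
    qed
    fix S assume "S \<subseteq> \<Union> (B ` {1..M})"
    then have S: "S \<subseteq> {2..n}" using B by blast
    show "monochromatic c Red S \<Longrightarrow> (\<Sum>s\<in>S. 1 / log 2 (real s)) \<le> X"
      "monochromatic c Blue S \<Longrightarrow> (\<Sum>s\<in>S. 1 / log 2 (real s)) \<le> X"
      using light[OF S] by (simp_all add: weight_def)
  qed (use X in auto)
  then show ?thesis by simp
qed

section \<open>The number of blocks, and the passage to \<open>f\<close>\<close>

lemma mono_clique_iff:
  "mono_clique n c S \<longleftrightarrow> S \<subseteq> {2..n} \<and> (\<exists>col. monochromatic c col S)"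
  by (simp add: mono_clique_def monochromatic_iff_nsets)

lemma eventually_heavy_mono_clique:
  "\<forall>\<^sub>F n in sequentially. \<forall>c. \<exists>S. mono_clique n c S \<and>
     weight S \<ge> 1 / 2 ^ 8 * log 2 (log 2 (log 2 (real n)))"
proof -
  define m where "m = (\<lambda>n::nat. log 2 (log 2 (real n)))"
  \<comment> \<open>Once 64 M^4 <= 2^M, this choice gives (64 M^4)^M <= 2^(M^2) <= log n, as the
    blocks need.\<close>
  define M where "M = (\<lambda>n. nat \<lfloor>sqrt (m n)\<rfloor>)"
  have m: "filterlim m at_top sequentially" unfolding m_def by real_asymp
  have "filterlim (\<lambda>x::real. nat \<lfloor>sqrt x\<rfloor>) at_top at_top"
    by (rule filterlim_compose[OF filterlim_nat_sequentially
          filterlim_compose[OF filterlim_floor_sequentially sqrt_at_top]])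
  then have M: "filterlim M at_top sequentially"
    unfolding M_def by (rule filterlim_compose[OF _ m])
  have "\<forall>\<^sub>F k::nat in at_top. 64 * real k ^ 4 \<le> 2 ^ k" by real_asymp
  then have "\<forall>\<^sub>F n in sequentially. 64 * real (M n) ^ 4 \<le> 2 ^ M n"
    by (rule eventually_compose_filterlim[OF _ M])
  moreover have "\<forall>\<^sub>F n in sequentially. 1 \<le> M n"
    using M by (simp add: filterlim_at_top)
  \<comment> \<open>The first conjunct yields \<open>X \<le> M\<close>, because sqrt (m n) < M +
    1.\<close>
  moreover have "\<forall>\<^sub>F x::real in at_top. log 2 x / 256 \<le> sqrt x - 1 \<and> 1 < x"
    by (intro eventually_conj; real_asymp)
  then have "\<forall>\<^sub>F n in sequentially. log 2 (m n) / 256 \<le> sqrt (m n) - 1 \<and> 1 < m n"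
    by (rule eventually_compose_filterlim[OF _ m])
  moreover have "\<forall>\<^sub>F n::nat in sequentially. 2 < n" by (rule eventually_gt_at_top)
  ultimately show ?thesis
  proof eventually_elim
    case (elim n)
    define X where "X = 1 / 2 ^ 8 * log 2 (log 2 (log 2 (real n)))"
    have X: "X = log 2 (m n) / 256" by (simp add: X_def m_def)
    have floor: "real (M n) \<le> sqrt (m n)" "sqrt (m n) < real (M n) + 1"
      using elim(3) by (auto simp: M_def)
    have "1 < log 2 (real n)" using elim(4) by simp
    define E where "E = (64 * M n ^ 4) ^ M n"
    have "E \<le> (2 ^ M n) ^ M n"
      unfolding E_def
    proof (rule power_mono)
      have "real (64 * M n ^ 4) \<le> real (2 ^ M n)" using elim(1) by simp
      then show "64 * M n ^ 4 \<le> 2 ^ M n" by (simp only: of_nat_le_iff)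
    qed simp
    then have "real E \<le> 2 powr (real (M n) * real (M n))"
      by (simp add: powr_realpow flip: power_mult of_nat_mult)
    also have "\<dots> \<le> 2 powr m n"
      using mult_mono[OF floor(1) floor(1)] elim(3) by (intro powr_mono) auto
    also have "\<dots> = log 2 n" using \<open>1 < log 2 (real n)\<close> by (simp add: m_def)
    finally have "2 powr (real E) \<le> 2 powr (log 2 n)"
      by (intro powr_mono) auto
    also have "\<dots> = n" using elim(4) by simp
    finally have "real (2 ^ E) \<le> real n" by (simp add: powr_realpow)
    then have n: "2 ^ ((64 * M n ^ 4) ^ M n) \<le> n" unfolding E_def by (simp only: of_nat_le_iff)
    show ?case
    proof (rule allI, rule ccontr)
      fix c assume "\<not> (\<exists>S. mono_clique n c S \<and> weight S \<ge> 1 / 2 ^ 8 * log 2 (log 2 (log 2 (real n))))"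
      then have light: "weight S \<le> X" if "S \<subseteq> {2..n}" "monochromatic c col S" for S col
        using that unfolding mono_clique_iff X_def by (meson linorder_linear)
      have "real (M n) + 1 \<le> exp (16 * X)"
        by (rule large_clique_weight[OF _ n _ light]) (use elim floor X in auto)
      also have "16 * X = log 2 (m n) / 16" by (simp add: X)
      \<comment> \<open>By ln 2 >= 1/2 the left side is at most ln (m n) / 8, while the right side
        is ln (m n) / 2 with m n > 1. The constant 2^-8 thus leaves room.\<close>
      also have "log 2 (m n) / 16 < ln (sqrt (m n))"
        using elim(3) ln_le_minus_one[of "1 / 2"] by (simp add: log_def ln_sqrt ln_div field_simps)
      then have "exp (log 2 (m n) / 16) < sqrt (m n)"
        using elim(3) by (metis exp_less_cancel_iff exp_ln less_trans real_sqrt_gt_0_iff zero_less_one)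
      also have "\<dots> < M n + 1" using floor by linarith
      finally show False by simp
    qed
  qed
qed

lemma f_col_ge: "mono_clique n c S \<Longrightarrow> weight S \<le> f_col n c"
  unfolding f_col_def using finite_mono_cliques by (intro Max_ge) auto

lemma f_attained: "\<exists>c\<in>edge_colorings n. f n = f_col n c"
proof -
  have "f n \<in> f_col n ` edge_colorings n"
    unfolding f_def using finite_edge_colorings edge_colorings_nonempty by (intro Min_in) auto
  then show ?thesis by auto
qed

section \<open>The upper bound\<close>

text \<open>The union bound for 2-coloring a uniform hypergraph, in counting form: \<open>R\<close>
  is the red part, and each hyperedge is monochromatic for at most 2 * 2^(card U - e) of the 2^(card
  U) choices.\<close>

lemma two_coloring_avoiding:
  assumes "finite U" "finite \<F>" "\<And>H. H \<in> \<F> \<Longrightarrow> H \<subseteq> U \<and> card H = e"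
    and few: "2 * card \<F> < 2 ^ e"
  shows "\<exists>R\<subseteq>U. \<forall>H\<in>\<F>. \<not> H \<subseteq> R \<and> H \<inter> R \<noteq> {}"
proof (rule ccontr)
  assume neg: "\<not> ?thesis"
  \<comment> \<open>The first part collects the \<open>R\<close> containing \<open>H\<close>, the
    second those disjoint from it.\<close>
  define T where "T = (\<lambda>H. (\<lambda>D. H \<union> D) ` Pow (U - H) \<union> Pow (U - H))"
  have cardT: "card (T H) * 2 ^ e \<le> 2 * 2 ^ card U" if "H \<in> \<F>" for H
  proof -
    have H: "H \<subseteq> U" "card H = e" using assms(3) that by auto
    have "finite H" using H(1) assms(1) by (rule finite_subset)
    have "card (T H) \<le> card ((\<lambda>D. H \<union> D) ` Pow (U - H)) + card (Pow (U - H))"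
      unfolding T_def by (rule card_Un_le)
    also have "\<dots> \<le> card (Pow (U - H)) + card (Pow (U - H))"
      using assms(1) by (intro add_right_mono card_image_le) auto
    also have "\<dots> = 2 * 2 ^ (card U - e)"
      using assms(1) H \<open>finite H\<close> by (simp add: card_Pow card_Diff_subset)
    finally have "card (T H) * 2 ^ e \<le> 2 * 2 ^ (card U - e) * 2 ^ e" by (rule mult_right_mono) simp
    also have "\<dots> = 2 * 2 ^ card U"
      using card_mono[OF assms(1) H(1)] H(2) by (simp flip: power_add)
    finally show ?thesis .
  qed
  have "Pow U \<subseteq> (\<Union>H\<in>\<F>. T H)"
  proof
    fix R assume "R \<in> Pow U"
    then obtain H where H: "H \<in> \<F>" "H \<subseteq> R \<or> H \<inter> R = {}" using neg by auto
    then have "R = H \<union> (R - H) \<and> R - H \<in> Pow (U - H) \<or> R \<in> Pow (U - H)"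
      using \<open>R \<in> Pow U\<close> by blast
    then have "R \<in> T H" unfolding T_def by blast
    then show "R \<in> (\<Union>H\<in>\<F>. T H)" using H(1) by blast
  qed
  then have "card (Pow U) \<le> card (\<Union>H\<in>\<F>. T H)"
    using assms(1,2) by (intro card_mono) (auto simp: T_def)
  also have "\<dots> \<le> (\<Sum>H\<in>\<F>. card (T H))" by (rule card_UN_le[OF assms(2)])
  finally have "2 ^ card U * 2 ^ e \<le> (\<Sum>H\<in>\<F>. card (T H)) * 2 ^ e"
    using assms(1) by (simp add: card_Pow)
  also have "\<dots> = (\<Sum>H\<in>\<F>. card (T H) * 2 ^ e)" by (rule sum_distrib_right)
  also have "\<dots> \<le> (\<Sum>H\<in>\<F>. 2 * 2 ^ card U)" by (intro sum_mono cardT)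
  also have "\<dots> = 2 ^ card U * (2 * card \<F>)" by simp
  finally show False using few by simp
qed

text \<open>The random-coloring lower bound for Ramsey numbers: the hyperedges are the edge sets of
  the \<open>k\<close>-subsets, to which \<open>two_coloring_avoiding\<close> applies.\<close>

lemma exists_coloring_small_cliques:
  "\<exists>g. \<forall>S col. S \<subseteq> {..<2 ^ m :: nat} \<longrightarrow> monochromatic g col S \<longrightarrow> card S \<le> 2 * m + 2"
proof -
  \<comment> \<open>With k - 1 = 2 (m + 1), k choose 2 is (m + 1) k, which exceeds the exponent m k
    + 1 of the union bound.\<close>
  define k where "k = 2 * m + 3"
  define \<F> where "\<F> = (\<lambda>S. [S]\<^bsup>2\<^esup>) ` ([{..<2 ^ m :: nat}]\<^bsup>k\<^esup>)"
  have "card \<F> \<le> card ([{..<2 ^ m :: nat}]\<^bsup>k\<^esup>)"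
    unfolding \<F>_def by (intro card_image_le finite_imp_finite_nsets) simp
  also have "\<dots> = 2 ^ m choose k" by simp
  also have "\<dots> \<le> (2 ^ m) ^ k"
    by (cases "k \<le> 2 ^ m") (simp_all add: binomial_le_pow binomial_eq_0)
  finally have "2 * card \<F> \<le> 2 ^ (m * k + 1)" by (simp add: power_mult)
  also have "\<dots> < 2 ^ (k choose 2)"
  proof (rule power_strict_increasing)
    have "k choose 2 = (2 * (m + 1) * k) div 2" unfolding choose_two k_def by (simp add: mult.commute)
    also have "\<dots> = m * k + k" by simp
    finally show "m * k + 1 < k choose 2" by (simp add: k_def)
  qed simp
  finally have few: "2 * card \<F> < 2 ^ (k choose 2)" .
  have "\<exists>R\<subseteq>[{..<2 ^ m :: nat}]\<^bsup>2\<^esup>. \<forall>H\<in>\<F>. \<not> H \<subseteq> R \<and> H \<inter> R \<noteq> {}"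
  proof (rule two_coloring_avoiding[OF _ _ _ few])
    show "H \<subseteq> [{..<2 ^ m :: nat}]\<^bsup>2\<^esup> \<and> card H = k choose 2" if "H \<in> \<F>" for H
      using that by (auto simp: \<F>_def nsets_def[of _ k] intro: nsets_mono[THEN subsetD])
  qed (simp_all add: \<F>_def finite_imp_finite_nsets)
  then obtain R where R: "\<And>H. H \<in> \<F> \<Longrightarrow> \<not> H \<subseteq> R \<and> H \<inter> R \<noteq> {}" by blast
  define g where "g = (\<lambda>e. if e \<in> R then Red else Blue)"
  have "card S \<le> 2 * m + 2" if S: "S \<subseteq> {..<2 ^ m}" "monochromatic g col S" for S col
  proof (rule ccontr)
    assume "\<not> ?thesis"
    then have "k \<le> card S" by (simp add: k_def)
    then obtain T where T: "T \<subseteq> S" "card T = k" "finite T" by (rule obtain_subset_with_card_n)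
    then have "T \<in> [{..<2 ^ m}]\<^bsup>k\<^esup>" using S(1) by (auto simp: nsets_def)
    then have "[T]\<^bsup>2\<^esup> \<in> \<F>" by (simp add: \<F>_def)
    moreover have "g e = col" if "e \<in> [T]\<^bsup>2\<^esup>" for e
      using monochromatic_subset[OF S(2) T(1)] that unfolding monochromatic_iff_nsets by blast
    ultimately show False using R[of "[T]\<^bsup>2\<^esup>"] color.distinct unfolding g_def
      by (metis IntE all_not_in_conv subsetI)
  qed
  then show ?thesis by blast
qed

section \<open>Coloring by double-exponential blocks\<close>

lemma log_log_floor:
  assumes "2 \<le> s"
  shows "2 ^ nat \<lfloor>log 2 (log 2 (real s))\<rfloor> \<le> log 2 (real s)"
    and "s < 2 ^ 2 ^ (nat \<lfloor>log 2 (log 2 (real s))\<rfloor> + 1)"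
proof -
  define i where "i = nat \<lfloor>log 2 (log 2 (real s))\<rfloor>"
  have 1: "1 \<le> log 2 (real s)" using assms by simp
  \<comment> \<open>As s >= 2, log log s is nonnegative and \<open>nat\<close> truncates
    nothing.\<close>
  have i: "real i \<le> log 2 (log 2 (real s))" "log 2 (log 2 (real s)) < real (i + 1)"
    using zero_le_log_cancel_iff[of 2 "log 2 (real s)"] 1 unfolding i_def by linarith+
  show "2 ^ nat \<lfloor>log 2 (log 2 (real s))\<rfloor> \<le> log 2 (real s)"
    using i(1) 1 unfolding i_def[symmetric] by (subst (asm) le_log_iff) (auto simp: powr_realpow)
  have "log 2 (real s) < 2 powr (real (i + 1))"
    using i(2) 1 by (subst (asm) log_less_iff) auto
  also have "\<dots> = real (2 ^ (i + 1))" by (subst powr_realpow) auto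
  finally have "real s < 2 powr real (2 ^ (i + 1))"
    using assms by (subst (asm) log_less_iff) auto
  also have "\<dots> = real (2 ^ 2 ^ (i + 1))" by (subst powr_realpow) auto
  finally show "s < 2 ^ 2 ^ (nat \<lfloor>log 2 (log 2 (real s))\<rfloor> + 1)"
    unfolding i_def[symmetric] by (simp only: of_nat_less_iff)
qed

lemma f_le:
  assumes u: "log 2 (log 2 (real n)) < 2 ^ u"
  shows "f n \<le> 12 * real u + 12"
proof -
  have "\<exists>g. \<forall>m S col. S \<subseteq> {..<2 ^ m :: nat} \<longrightarrow> monochromatic (g m) col S \<longrightarrow> card S \<le> 2 * m + 2"
    using exists_coloring_small_cliques by (intro choice allI) blast
  then obtain g where g: "\<And>m S col. S \<subseteq> {..<2 ^ m :: nat} \<Longrightarrow> monochromatic (g m) col S \<Longrightarrow> card S \<le> 2 * m + 2"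
    by blast
  define blk where "blk = (\<lambda>s::nat. nat \<lfloor>log 2 (log 2 (real s))\<rfloor>)"
  \<comment> \<open>Colorings take edges as sets, so the endpoints are recovered by
    \<open>Min\<close> and \<open>Max\<close>. Block \<open>i\<close> lies below 2^(2^(i+1)), hence
    the parameter of the inner coloring; the block indices lie below 2^u.\<close>
  define c where "c = restrict (\<lambda>e. if blk (Min e) = blk (Max e)
      then g (2 ^ (blk (Min e) + 1)) e else g u (blk ` e)) ([{2..n}]\<^bsup>2\<^esup>)"
  have c_edge: "c {x, y} = (if blk x = blk y then g (2 ^ (blk x + 1)) {x, y} else g u {blk x, blk y})"
    if "x \<in> {2..n}" "y \<in> {2..n}" "x \<noteq> y" for x y
    using that by (auto simp: c_def nsets_def min_def max_def insert_commute)
  have c: "c \<in> edge_colorings n" by (simp add: c_def edge_colorings_def)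
  have le: "weight S \<le> 12 * real u + 12" if "mono_clique n c S" for S
  proof -
    obtain col where S: "S \<subseteq> {2..n}" "monochromatic c col S"
      using \<open>mono_clique n c S\<close> by (auto simp: mono_clique_iff)
    have "finite S" using S(1) by (rule finite_subset) simp
    have c_S: "(if blk x = blk y then g (2 ^ (blk x + 1)) {x, y} else g u {blk x, blk y}) = col"
      if "x \<in> S" "y \<in> S" "x \<noteq> y" for x y
    proof -
      have "x \<in> {2..n}" "y \<in> {2..n}" "c {x, y} = col"
        using that S by (auto simp: monochromatic_def)
      then show ?thesis using c_edge[of x y] \<open>x \<noteq> y\<close> by simp
    qed
    have "monochromatic (g u) col (blk ` S)"
      unfolding monochromatic_def using c_S by fastforce
    moreover have "blk ` S \<subseteq> {..<2 ^ u}"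
    proof
      fix i assume "i \<in> blk ` S"
      then obtain s where s: "s \<in> S" "i = blk s" by blast
      then have "2 \<le> s" "s \<le> n" using S(1) by auto
      then have "log 2 (log 2 (real s)) \<le> log 2 (log 2 (real n))" "1 \<le> log 2 (real s)"
        by (auto intro!: log_mono)
      then have "real i \<le> log 2 (log 2 (real n))"
        using zero_le_log_cancel_iff[of 2 "log 2 (real s)"] unfolding s blk_def by linarith
      also have "\<dots> < real (2 ^ u)" using u by simp
      finally have "real i < real (2 ^ u)" .
      then show "i \<in> {..<2 ^ u}" by (simp only: of_nat_less_iff lessThan_iff)
    qed
    ultimately have blocks: "card (blk ` S) \<le> 2 * u + 2" using g by blast
    have block: "(\<Sum>s | s \<in> S \<and> blk s = i. 1 / log 2 (real s)) \<le> 6" for i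
    proof -
      let ?S = "{s \<in> S. blk s = i}"
      have "monochromatic (g (2 ^ (i + 1))) col ?S"
        unfolding monochromatic_def
      proof (intro ballI impI)
        fix x y assume "x \<in> ?S" "y \<in> ?S" "x \<noteq> y"
        then show "g (2 ^ (i + 1)) {x, y} = col" using c_S[of x y] by simp
      qed
      moreover have "?S \<subseteq> {..<2 ^ 2 ^ (i + 1)}"
        using S(1) log_log_floor(2) by (auto simp: blk_def)
      ultimately have "card ?S \<le> 2 * 2 ^ (i + 1) + 2" using g by blast
      \<comment> \<open>As each vertex of block \<open>i\<close> weighs at most 1 / 2^i, the block
        contributes at most 6; with 2 u + 2 blocks the total is 12 u + 12.\<close>
      also have "\<dots> \<le> 6 * 2 ^ i" by simp
      finally have "real (card ?S) \<le> real (6 * 2 ^ i)" by (simp only: of_nat_le_iff)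
      have "(\<Sum>s\<in>?S. 1 / log 2 (real s)) \<le> (\<Sum>s\<in>?S. 1 / 2 ^ i)"
      proof (rule sum_mono)
        fix s assume "s \<in> ?S"
        then have "2 ^ i \<le> log 2 (real s)" using S(1) log_log_floor(1)[of s] by (auto simp: blk_def)
        moreover have "(0::real) < 2 ^ i" by simp
        then have "0 < log 2 (real s)" using calculation by linarith
        ultimately show "1 / log 2 (real s) \<le> 1 / 2 ^ i"
          by (intro divide_left_mono mult_pos_pos) auto
      qed
      also have "\<dots> = card ?S / 2 ^ i" by simp
      also have "\<dots> \<le> 6" using \<open>real (card ?S) \<le> real (6 * 2 ^ i)\<close> by (simp add: field_simps)
      finally show ?thesis .
    qed
    have "weight S = (\<Sum>i\<in>blk ` S. \<Sum>s | s \<in> S \<and> blk s = i. 1 / log 2 (real s))"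
      unfolding weight_def by (rule sum.image_gen[OF \<open>finite S\<close>])
    also have "\<dots> \<le> (\<Sum>i\<in>blk ` S. 6)" by (intro sum_mono block)
    also have "\<dots> \<le> 6 * real (2 * u + 2)" using blocks by simp
    finally show ?thesis by simp
  qed
  have "f n \<le> f_col n c"
    unfolding f_def using c finite_edge_colorings by (intro Min_le) auto
  also have "\<dots> \<le> 12 * real u + 12"
    unfolding f_col_def using finite_mono_cliques mono_cliques_nonempty le by (subst Max_le_iff) auto
  finally show ?thesis .
qed

theorem theorem1p1:
  shows "(\<exists>N. \<forall>n\<ge>N. \<forall>c \<in> edge_colorings n. \<exists>S. mono_clique n c S \<and>
            (\<Sum>s\<in>S. 1 / log 2 (real s)) \<ge> 1 / 2 ^ 8 * log 2 (log 2 (log 2 (real n))))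
       \<and> f \<in> \<Theta>(\<lambda>n. log 2 (log 2 (log 2 (real n))))"
proof
  let ?lll = "\<lambda>n::nat. log 2 (log 2 (log 2 (real n)))"
  show "\<exists>N. \<forall>n\<ge>N. \<forall>c \<in> edge_colorings n. \<exists>S. mono_clique n c S \<and>
            (\<Sum>s\<in>S. 1 / log 2 (real s)) \<ge> 1 / 2 ^ 8 * ?lll n"
    using eventually_heavy_mono_clique unfolding eventually_sequentially weight_def by blast
  have large: "\<forall>\<^sub>F n in sequentially. 1 \<le> ?lll n \<and> 1 \<le> log 2 (log 2 (real n))"
    by (intro eventually_conj; real_asymp)
  have lower: "\<forall>\<^sub>F n in sequentially. ?lll n \<le> 256 * f n"
    using eventually_heavy_mono_clique
  proof eventually_elim
    case (elim n)
    obtain c where "f n = f_col n c" using f_attained by blast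
    moreover obtain S where "mono_clique n c S" "1 / 2 ^ 8 * ?lll n \<le> weight S" using elim by blast
    ultimately show ?case using f_col_ge[of n c S] by simp
  qed
  show "f \<in> \<Theta>(?lll)"
  proof (rule bigthetaI)
    show "f \<in> O(?lll)"
    \<comment> \<open>For u <= lll + 1 the bound 12 u + 12 is at most 12 lll + 24, hence at most 36
      lll once lll >= 1. The lower bound serves to show that f n is nonnegative.\<close>
    proof (rule bigoI[where c = 36])
      show "\<forall>\<^sub>F n in sequentially. norm (f n) \<le> 36 * norm (?lll n)"
        using large lower
      proof eventually_elim
        case (elim n)
        define u where "u = nat \<lfloor>?lll n\<rfloor> + 1"
        have u: "?lll n < real u" "real u \<le> ?lll n + 1"
          using elim(1) unfolding u_def by linarith+
        then have "log 2 (log 2 (real n)) < 2 powr (real u)"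
          using elim(1) by (subst (asm) log_less_iff) auto
        then have "f n \<le> 12 * real u + 12" by (intro f_le) (simp add: powr_realpow)
        then show ?case using u elim by simp
      qed
    qed
    show "f \<in> \<Omega>(?lll)"
    proof (rule landau_omega.bigI[where c = "1 / 256"])
      show "\<forall>\<^sub>F n in sequentially. 1 / 256 * norm (?lll n) \<le> norm (f n)"
        using large lower by eventually_elim simp
    qed simp
  qed
qed

end
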